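(* Suppose the Hardy–Littlewood conjecture holds for every admissible $m$-tuple (for every $m$). Then there are infinitely many finite sets of prime numbers that are MSTD sets.
   Context: For a finite set $S$ of integers, $S+S = \{x+y : x,y \in S\}$ and $S-S = \{x-y : x,y\in S\}$; $S$ is an MSTD (More Sums Than Differences) set if $|S+S| > |S-S|$. An $m$-tuple $(b_1,\dots,b_m)$ of distinct integers is admissible if for every integer $k \ge 2$ the set $\{b_1,\dots,b_m\}$ does not contain a representative of every residue class modulo $k$. The Hardy–Littlewood conjecture for $(b_1,\dots,b_m)$ asserts: letting $P(x) = P(x; b_1,\dots,b_m)$ be the number of integers $1 \le n \le x$ such that $n+b_1,\dots,n+b_m$ are all prime, one has $P(x) \sim G(b_1,\dots,b_m)\int_2^x \frac{du}{(\log u)^m}$ as $x \to \infty$, where $G(b_1,\dots,b_m) = \prod_{p} \left(\frac{p}{p-1}\right)^{m-1}\frac{p-v(p)}{p-1}$, the product over all primes $p$, and $v(p)$ is the number of distinct residues of $b_1,\dots,b_m$ modulo $p$. *)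

theory Defs
  imports "HOL-Analysis.Analysis" "HOL-Number_Theory.Number_Theory" "HOL-Library.Landau_Symbols"
begin

definition sumset :: "int set \<Rightarrow> int set" where
  "sumset S = {x + y | x y. x \<in> S \<and> y \<in> S}"

definition diffset :: "int set \<Rightarrow> int set" where
  "diffset S = {x - y | x y. x \<in> S \<and> y \<in> S}"

definition MSTD :: "int set \<Rightarrow> bool" where
  "MSTD S \<longleftrightarrow> finite S \<and> card (sumset S) > card (diffset S)"

text \<open>An \<open>m\<close>-tuple of integers is a list of length \<open>m\<close>.\<close>

definition admissible :: "int list \<Rightarrow> bool" where
  "admissible bs \<longleftrightarrow> distinct bs \<and>
     (\<forall>k::int. k \<ge> 2 \<longrightarrow> \<not> (\<forall>r. \<exists>b\<in>set bs. [b = r] (mod k)))"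

definition residue_count :: "int list \<Rightarrow> nat \<Rightarrow> nat" where
  "residue_count bs p = card ((\<lambda>b. b mod int p) ` set bs)"

definition prime_tuple_count :: "int list \<Rightarrow> real \<Rightarrow> nat" where
  "prime_tuple_count bs x =
     card {n::int. 1 \<le> n \<and> real_of_int n \<le> x \<and> (\<forall>b\<in>set bs. prime (n + b))}"

text \<open>The product over all primes is taken in increasing order. For admissible tuples no factor
  vanishes, and the factors are \<open>1 + O(1/p\<^sup>2)\<close>, so \<^const>\<open>prodinf\<close> is a genuine limit here.\<close>

definition singular_series :: "int list \<Rightarrow> real" where
  "singular_series bs =
     (\<Prod>p::nat. if prime p
        then (real p / (real p - 1)) powi (int (length bs) - 1)
               * ((real p - real (residue_count bs p)) / (real p - 1))
        else 1)"

definition hardy_littlewood :: "int list \<Rightarrow> bool" where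
  "hardy_littlewood bs \<longleftrightarrow>
     (\<lambda>x. real (prime_tuple_count bs x)) \<sim>[at_top]
     (\<lambda>x. singular_series bs * integral {2..x} (\<lambda>u. 1 / ln u ^ length bs))"

end

theory Submission
  imports Defs "HOL-Real_Asymp.Real_Asymp"
begin

text \<open>
  Let \<open>A\<close> be Conway's MSTD set. Every element of \<open>210 A\<close> is divisible by 2, 3, 5 and 7, and
  \<open>A\<close> has only eight elements, so \<open>210 A\<close> is admissible. The singular series of an admissible tuple
  has nonzero factors \<open>1 + O(1/p\<^sup>2)\<close>, hence does not vanish, and the integral in the conjecture
  diverges; so infinitely many translates of \<open>210 A\<close> consist of primes. The MSTD property is
  invariant under injective affine maps.
\<close>

section \<open>The singular series\<close>

text \<open>Upper companion to Bernoulli's inequality. The coefficient \<open>m\<^sup>2\<close> is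
  cruder than needed, but lets the induction close: what it discards,
  \<open>(m + 1) * x\<^sup>2 + m\<^sup>2 * x ^ 3\<close>, is nonnegative.\<close>

lemma one_minus_power_le_quadratic:
  fixes x :: real
  assumes "0 \<le> x" "x \<le> 1"
  shows "(1 - x) ^ m \<le> 1 - real m * x + (real m)\<^sup>2 * x\<^sup>2"
proof (induction m)
  case (Suc m)
  have "(1 - x) ^ Suc m \<le> (1 - x) * (1 - real m * x + (real m)\<^sup>2 * x\<^sup>2)"
    using Suc assms by (simp add: mult_left_mono)
  also have "\<dots> = 1 - real (Suc m) * x + (real (Suc m))\<^sup>2 * x\<^sup>2
      - ((real m + 1) * x\<^sup>2 + (real m)\<^sup>2 * x ^ 3)"
    by (simp add: algebra_simps power2_eq_square power3_eq_cube)
  also have "\<dots> \<le> 1 - real (Suc m) * x + (real (Suc m))\<^sup>2 * x\<^sup>2"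
  proof -
    have "0 \<le> (real m + 1) * x\<^sup>2 + (real m)\<^sup>2 * x ^ 3"
      using assms by (intro add_nonneg_nonneg mult_nonneg_nonneg zero_le_power) auto
    thus ?thesis by linarith
  qed
  finally show ?case .
qed simp

text \<open>With \<open>x = 1 / p\<close> the factor is \<open>(1 - m * x) / (1 - x) ^ m\<close>,
  whose numerator and denominator agree to first order in \<open>x\<close>. Since
  \<open>x \<le> 1/2\<close>, the denominator costs at most \<open>2 ^ m\<close>.\<close>

lemma abs_euler_factor_minus_one_le:
  fixes p :: real
  assumes "p \<ge> 2" "m \<ge> 1"
  shows "\<bar>(p / (p - 1)) ^ (m - 1) * ((p - real m) / (p - 1)) - 1\<bar>
           \<le> 2 ^ m * (real m)\<^sup>2 * inverse (p ^ 2)"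
proof -
  define x where "x = 1 / p"
  have x: "0 < x" "x \<le> 1/2" "p = 1 / x"
    using assms by (auto simp: x_def field_simps)
  have lower: "1 - real m * x \<le> (1 - x) ^ m"
    using Bernoulli_inequality[of "- x" m] x by simp
  have upper: "(1 - x) ^ m \<le> 1 - real m * x + (real m)\<^sup>2 * x\<^sup>2"
    using x by (intro one_minus_power_le_quadratic) auto
  have pos: "(1 - x) ^ m > 0"
    using x by simp
  have "(1/2) ^ m \<le> (1 - x) ^ m"
    using x by (intro power_mono) auto
  hence inv: "1 / (1 - x) ^ m \<le> 2 ^ m"
    using pos by (simp add: field_simps power_divide)
  have "p / (p - 1) = 1 / (1 - x)" "(p - real m) / (p - 1) = (1 - real m * x) / (1 - x)"
    using assms by (simp_all add: x_def field_simps)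
  moreover obtain l where "m = Suc l"
    using assms by (cases m) auto
  ultimately have "(p / (p - 1)) ^ (m - 1) * ((p - real m) / (p - 1))
      = (1 - real m * x) / (1 - x) ^ m"
    by (simp add: power_divide)
  also have "\<dots> = 1 - ((1 - x) ^ m - (1 - real m * x)) * (1 / (1 - x) ^ m)"
    using x by (simp add: field_simps)
  finally have "\<bar>(p / (p - 1)) ^ (m - 1) * ((p - real m) / (p - 1)) - 1\<bar>
      = ((1 - x) ^ m - (1 - real m * x)) * (1 / (1 - x) ^ m)"
    using lower pos by simp
  also have "\<dots> \<le> ((real m)\<^sup>2 * x\<^sup>2) * 2 ^ m"
    using lower upper inv pos by (intro mult_mono) auto
  also have "\<dots> = 2 ^ m * (real m)\<^sup>2 * inverse (p ^ 2)"
    by (simp add: x_def field_simps)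
  finally show ?thesis .
qed

text \<open>This keeps the numerator of every Euler factor positive.\<close>

lemma residue_count_less:
  assumes "admissible bs" "p \<ge> 2"
  shows "residue_count bs p < p"
proof -
  have "\<not> (\<forall>r. \<exists>b\<in>set bs. [b = r] (mod int p))"
    using assms unfolding admissible_def by auto
  then obtain r where r: "\<forall>b\<in>set bs. b mod int p \<noteq> r mod int p"
    unfolding cong_def by auto
  hence "(\<lambda>b. b mod int p) ` set bs \<subset> {0..<int p}"
    using assms by (intro psubsetI) (auto simp: set_eq_iff intro!: exI[of _ "r mod int p"])
  hence "card ((\<lambda>b. b mod int p) ` set bs) < card {0..<int p}"
    by (intro psubset_card_mono) auto
  thus ?thesis by (simp add: residue_count_def)
qed

text \<open>Distinct integers stay distinct modulo \<open>p\<close> once \<open>p\<close> exceeds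
  all their differences. The quadratic estimate of the Euler factor thus applies to all but finitely
  many primes.\<close>

lemma eventually_residue_count_eq_length:
  assumes "distinct bs"
  shows "eventually (\<lambda>p. residue_count bs p = length bs) sequentially"
proof -
  define N where "N = (\<Sum>b\<in>set bs. nat \<bar>b\<bar>)"
  have bound: "\<bar>b\<bar> \<le> int N" if "b \<in> set bs" for b
    using member_le_sum[of b "set bs" "\<lambda>b. nat \<bar>b\<bar>"] that
    unfolding N_def by (simp del: of_nat_sum)
  have "residue_count bs p = length bs" if "p > 2 * N" for p
  proof -
    have "inj_on (\<lambda>b. b mod int p) (set bs)"
    proof (rule inj_onI)
      fix b c assume bc: "b \<in> set bs" "c \<in> set bs" "b mod int p = c mod int p"
      have "int p dvd b - c"
        using bc by (simp add: mod_eq_dvd_iff)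
      moreover have "\<bar>b - c\<bar> < int p"
        using bound[of b] bound[of c] bc that by linarith
      ultimately show "b = c"
        using zdvd_imp_le[of "int p" "\<bar>b - c\<bar>"] by fastforce
    qed
    thus ?thesis
      using assms by (simp add: residue_count_def card_image distinct_card)
  qed
  thus ?thesis
    by (auto simp: eventually_sequentially intro!: exI[of _ "Suc (2 * N)"])
qed

lemma singular_series_nonzero:
  assumes "bs \<noteq> []" "admissible bs"
  shows "singular_series bs \<noteq> 0"
proof -
  define m where "m = length bs"
  have m: "m \<ge> 1"
    using assms by (cases bs) (auto simp: m_def)
  define f where "f = (\<lambda>p::nat. if prime p
        then (real p / (real p - 1)) powi (int (length bs) - 1)
               * ((real p - real (residue_count bs p)) / (real p - 1))
        else 1)"
  have "eventually (\<lambda>p. residue_count bs p = m) sequentially"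
    using eventually_residue_count_eq_length[of bs] assms
    by (simp add: admissible_def m_def)
  hence "eventually (\<lambda>p. norm (norm (f p - 1)) \<le> 2 ^ m * (real m)\<^sup>2 * inverse (real p ^ 2)) sequentially"
  proof eventually_elim
    case (elim p)
    show ?case
    proof (cases "prime p")
      case True
      \<comment> \<open>As \<open>m \<ge> 1\<close>, the exponent is a natural number and
        \<open>powi\<close> turns into an ordinary power.\<close>
      have "int (length bs) - 1 = int (m - 1)"
        using m by (simp add: m_def)
      hence "f p = (real p / (real p - 1)) ^ (m - 1) * ((real p - real m) / (real p - 1))"
        unfolding f_def using True elim by (simp del: of_nat_diff)
      thus ?thesis
        using abs_euler_factor_minus_one_le[of "real p" m] m prime_ge_2_nat[OF True] by simp
    qed (simp add: f_def)
  qed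
  moreover have "summable (\<lambda>p. 2 ^ m * (real m)\<^sup>2 * inverse (real p ^ 2))"
    by (intro summable_mult inverse_power_summable) simp
  ultimately have "summable (\<lambda>p. norm (f p - 1))"
    by (rule summable_comparison_test_ev)
  hence "convergent_prod f"
    by (simp add: abs_convergent_prod_conv_summable abs_convergent_prod_imp_convergent_prod)
  moreover have "f p \<noteq> 0" for p
  proof (cases "prime p")
    case True
    thus ?thesis
      using residue_count_less[OF assms(2) prime_ge_2_nat[OF True]] prime_ge_2_nat[OF True]
      by (auto simp: f_def)
  qed (simp add: f_def)
  ultimately have "prodinf f \<noteq> 0"
    by (rule prodinf_nonzero)
  thus ?thesis
    by (simp add: singular_series_def f_def)
qed

section \<open>Infinitely many prime tuples\<close>

text \<open>The integrand decreases on \<open>{2..x}\<close>, so its value at the right endpoint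
  times the length \<open>x - 2\<close> is a lower bound, and this already diverges.\<close>

lemma integral_inverse_ln_power_at_top:
  "filterlim (\<lambda>x. integral {2..x} (\<lambda>u::real. 1 / ln u ^ m)) at_top at_top"
proof (rule filterlim_at_top_mono)
  show "filterlim (\<lambda>x::real. (x - 2) * (1 / ln x ^ m)) at_top at_top"
    by real_asymp
  show "eventually (\<lambda>x::real. (x - 2) * (1 / ln x ^ m) \<le> integral {2..x} (\<lambda>u. 1 / ln u ^ m)) at_top"
    using eventually_ge_at_top[of "2::real"]
  proof eventually_elim
    case (elim x)
    have "integral {2..x} (\<lambda>u. 1 / ln x ^ m) \<le> integral {2..x} (\<lambda>u::real. 1 / ln u ^ m)"
    proof (rule integral_le)
      show "(\<lambda>u::real. 1 / ln u ^ m) integrable_on {2..x}"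
        by (intro integrable_continuous_interval continuous_intros) auto
      show "1 / ln x ^ m \<le> 1 / ln u ^ m" if "u \<in> {2..x}" for u
        using that by (intro divide_left_mono power_mono mult_pos_pos zero_less_power) auto
    qed (rule integrable_const_ivl)
    thus ?case using elim by simp
  qed
qed

lemma infinite_prime_translates:
  assumes "bs \<noteq> []" "admissible bs" "hardy_littlewood bs"
  shows "infinite {n::int. \<forall>b\<in>set bs. prime (n + b)}"
proof
  define T where "T = {n::int. \<forall>b\<in>set bs. prime (n + b)}"
  assume "finite {n::int. \<forall>b\<in>set bs. prime (n + b)}"
  hence fin: "finite T" by (simp add: T_def)
  have bound: "prime_tuple_count bs x \<le> card T" for x
    unfolding prime_tuple_count_def by (intro card_mono[OF fin]) (auto simp: T_def)
  \<comment> \<open>The filter is \<open>at_infinity\<close> because the singular series is only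
    known to be nonzero; its sign is left open.\<close>
  have "filterlim (\<lambda>x. integral {2..x} (\<lambda>u::real. 1 / ln u ^ length bs)) at_infinity at_top"
    by (intro filterlim_at_top_imp_at_infinity integral_inverse_ln_power_at_top)
  hence "filterlim (\<lambda>x. singular_series bs * integral {2..x} (\<lambda>u. 1 / ln u ^ length bs))
      at_infinity at_top"
    by (intro tendsto_mult_filterlim_at_infinity[OF tendsto_const]
        singular_series_nonzero[OF assms(1,2)])
  hence "filterlim (\<lambda>x. real (prime_tuple_count bs x)) at_infinity at_top"
    using assms(3) unfolding hardy_littlewood_def
    by (metis asymp_equiv_at_infinity_transfer asymp_equiv_sym)
  hence "eventually (\<lambda>x. norm (real (prime_tuple_count bs x)) \<ge> real (card T) + 1) at_top"
    by (auto simp: filterlim_at_infinity[of 0])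
  then obtain x where "real (prime_tuple_count bs x) \<ge> real (card T) + 1"
    by (auto dest: eventually_happens)
  thus False using bound[of x] by linarith
qed

section \<open>MSTD sets\<close>

text \<open>As unions of images, sumsets and difference sets of explicit finite sets can be
  evaluated, and affine maps can be moved through them.\<close>

lemma sumset_eq_UN: "sumset S = (\<Union>x\<in>S. (\<lambda>y. x + y) ` S)"
  by (auto simp: sumset_def)

lemma diffset_eq_UN: "diffset S = (\<Union>x\<in>S. (\<lambda>y. x - y) ` S)"
  by (auto simp: diffset_def)

lemma MSTD_affine_image:
  assumes "MSTD S" "d \<noteq> 0"
  shows "MSTD ((\<lambda>a. n + d * a) ` S)"
proof -
  have "sumset ((\<lambda>a. n + d * a) ` S) = (\<lambda>s. 2 * n + d * s) ` sumset S"
    by (force simp: sumset_eq_UN image_UN image_image algebra_simps)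
  moreover have "diffset ((\<lambda>a. n + d * a) ` S) = (*) d ` diffset S"
    by (force simp: diffset_eq_UN image_UN image_image algebra_simps)
  moreover have "inj (\<lambda>s. 2 * n + d * s)" "inj ((*) d)"
    using assms by (auto intro: injI)
  ultimately show ?thesis
    using assms by (simp add: MSTD_def card_image inj_on_subset[OF _ subset_UNIV])
qed

definition conway_list :: "int list" where
  "conway_list = [0, 2, 3, 4, 7, 11, 12, 14]"

lemma MSTD_conway: "MSTD (set conway_list)"
proof -
  \<comment> \<open>There are 29 - 3 = 26 sums against 29 - 4 = 25 differences.\<close>
  have "sumset (set conway_list) = {0..28} - {1, 20, 27}"
    unfolding sumset_eq_UN conway_list_def by code_simp
  moreover have "diffset (set conway_list) = {-14..14} - {-13, -6, 6, 13}"
    unfolding diffset_eq_UN conway_list_def by code_simp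
  ultimately show ?thesis
    by (simp add: MSTD_def card_Diff_subset)
qed

lemma admissible_scaled_conway: "admissible (map ((*) 210) conway_list)"
  unfolding admissible_def
proof (intro conjI allI impI notI)
  show "distinct (map ((*) 210) conway_list)"
    by (simp add: conway_list_def)
next
  fix k :: int
  assume k: "k \<ge> 2" and cover: "\<forall>r. \<exists>b\<in>set (map ((*) 210) conway_list). [b = r] (mod k)"
  have "{0..<k} \<subseteq> (\<lambda>b. b mod k) ` set (map ((*) 210) conway_list)"
  proof
    fix r assume "r \<in> {0..<k}"
    hence "r mod k = r" by simp
    moreover obtain b where "b \<in> set (map ((*) 210) conway_list)" "[b = r] (mod k)"
      using cover by blast
    ultimately show "r \<in> (\<lambda>b. b mod k) ` set (map ((*) 210) conway_list)"
      by (metis cong_def image_eqI)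
  qed
  \<comment> \<open>Eight integers meet at most eight residue classes, which leaves only
    \<open>k \<le> 8\<close>.\<close>
  hence "card {0..<k} \<le> card ((\<lambda>b. b mod k) ` set (map ((*) 210) conway_list))"
    by (intro card_mono) auto
  also have "\<dots> \<le> card (set (map ((*) 210) conway_list))"
    by (intro card_image_le) auto
  also have "\<dots> \<le> 8"
    by (simp add: conway_list_def)
  finally have "k \<le> 8" using k by simp
  hence "k \<in> {2, 3, 4, 5, 6, 7, 8}" using k by auto
  \<comment> \<open>\<open>q\<close> is a prime factor of \<open>k\<close> among 2, 3, 5, 7. A
    multiple of 210 in the class of 1 modulo \<open>k\<close> would force \<open>q\<close> to divide
    1.\<close>
  then obtain q :: int where q: "q dvd k" "q dvd 210" "\<not> q dvd 1"
    by (elim insertE) (auto intro: that[of 2] that[of 3] that[of 5] that[of 7])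
  from cover obtain a where "[210 * a = 1] (mod k)" by auto
  hence "[210 * a = 1] (mod q)" using q(1) by (rule cong_dvd_modulus)
  moreover have "q dvd 210 * a" using q(2) by (rule dvd_mult2)
  ultimately show False using q(3) cong_dvd_iff by blast
qed

theorem theorem3p2:
  assumes "\<And>bs. bs \<noteq> [] \<Longrightarrow> admissible bs \<Longrightarrow> hardy_littlewood bs"
  shows "infinite {S :: int set. finite S \<and> (\<forall>p\<in>S. prime p) \<and> MSTD S}"
proof
  define bs where "bs = map ((*) 210) conway_list"
  define T where "T = {n::int. \<forall>b\<in>set bs. prime (n + b)}"
  have ne: "bs \<noteq> []" by (simp add: bs_def conway_list_def)
  have adm: "admissible bs" unfolding bs_def by (rule admissible_scaled_conway)
  have inf: "infinite T"
    unfolding T_def using infinite_prime_translates[OF ne adm assms[OF ne adm]] .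
  let ?F = "{S :: int set. finite S \<and> (\<forall>p\<in>S. prime p) \<and> MSTD S}"
  assume "finite ?F"
  \<comment> \<open>Passing to the union avoids comparing the sets attached to different
    \<open>n\<close>: finitely many finite sets cover only finitely many integers.\<close>
  hence "finite (\<Union>?F)" by blast
  moreover have "T \<subseteq> \<Union>?F"
  proof
    fix n assume n: "n \<in> T"
    define S where "S = (\<lambda>a. n + 210 * a) ` set conway_list"
    \<comment> \<open>Conway's set contains 0, so the translate by \<open>n\<close> contains
      \<open>n\<close> itself.\<close>
    have "n \<in> S" by (force simp: S_def conway_list_def)
    moreover have "MSTD S"
      unfolding S_def by (intro MSTD_affine_image MSTD_conway) simp
    moreover have "\<forall>p\<in>S. prime p"
      using n by (auto simp: T_def S_def bs_def)
    ultimately show "n \<in> \<Union>?F"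
      by (auto simp: MSTD_def)
  qed
  ultimately show False using inf finite_subset by blast
qed

end
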